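(* Let $\alpha=(0^{i_1},s_1,\ldots,0^{i_k},s_k)$ be a left weak composition with $i_p\geq0$, $s_p\geq1$. Then $$F_\alpha=\sum_{\beta\preceq\alpha}c_{\alpha,\beta}M_\beta,$$ where for $\beta=(0^{j_1},\beta_1,\ldots,0^{j_k},\beta_k)\preceq\alpha$ (with $\beta_p$ a composition of $s_p$ and $0\leq j_p\leq i_p$) one sets $c_{\alpha,\beta}=\binom{i_1}{j_1}\cdots\binom{i_k}{j_k}$; in particular $c_{\alpha,\alpha}=1$. Moreover, the elements $F_\alpha$, as $\alpha$ runs through all left weak compositions, together with $F_\emptyset=1$, form a $\mathbb{Q}$-basis of $\mathrm{LWCQSym}$.
   Context: Coefficients are in $\mathbb{Q}$; $x_1,x_2,\ldots$ are commuting variables; $0^i$ denotes $i$ zero entries. A left weak composition is a finite nonempty sequence of nonnegative integers whose last entry is positive; a composition of $s$ is a nonempty finite sequence of positive integers summing to $s$. For a left weak composition $\gamma=(\gamma_1,\ldots,\gamma_r)$, $M_\gamma=\sum_{1\leq n_1<\cdots<n_r}x_{n_1}^{\gamma_1}\cdots x_{n_r}^{\gamma_r}$. $\mathrm{LWCQSym}$ is the $\mathbb{Q}$-span of $1$ and all $M_\gamma$. Partial order: for left weak compositions $\alpha=(0^{i_1},s_1,\ldots,0^{i_k},s_k)$ ($s_p\geq1$) and $\beta$ of the same size, $\beta\preceq\alpha$ iff $\beta$ can be written as $(0^{j_1},\beta_1,\ldots,0^{j_k},\beta_k)$ where $0\leq j_p\leq i_p$ and $\beta_p$ is a composition of $s_p$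 for each $p$ (the $\beta_p$ written out as consecutive entries). With $a_p=i_1+s_1+\cdots+i_p+s_p$ ($a_0=0$), the LWC fundamental quasi-symmetric function is $$F_\alpha=\sum x_{n_1}^0\cdots x_{n_{i_1}}^0x_{n_{i_1+1}}\cdots x_{n_{a_1}}\cdots x_{n_{a_{k-1}+1}}^0\cdots x_{n_{a_{k-1}+i_k}}^0x_{n_{a_{k-1}+i_k+1}}\cdots x_{n_{a_k}},$$ summed over $1\leq n_1\leq\cdots\leq n_{a_1}<n_{a_1+1}\leq\cdots<n_{a_{k-1}+1}\leq\cdots\leq n_{a_k}$ (weak inequalities everywhere except strict at positions $a_1,\ldots,a_{k-1}$). *)

theory Defs
  imports Complex_Main "HOL-Library.Poly_Mapping" "HOL-Library.Function_Algebras"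
begin

text \<open>
  A formal power series over the rationals in commuting variables indexed by \<open>nat\<close> is its
  coefficient function on exponent vectors. The variables that occur are \<open>x\<^sub>n\<close> with \<open>n \<ge> 1\<close>.
\<close>

type_synonym series = "(nat \<Rightarrow>\<^sub>0 nat) \<Rightarrow> rat"

definition series_scale :: "rat \<Rightarrow> series \<Rightarrow> series" where
  "series_scale q f = (\<lambda>m. q * f m)"

global_interpretation series: vector_space series_scale
  by unfold_locales (auto simp: series_scale_def plus_fun_def algebra_simps)

definition series_one :: series where
  "series_one = Poly_Mapping.lookup 1"

definition var :: "nat \<Rightarrow> (nat \<Rightarrow>\<^sub>0 nat) \<Rightarrow>\<^sub>0 rat" where
  "var n = Poly_Mapping.single (Poly_Mapping.single n 1) 1"

text \<open>
  The coefficientwise sum of a family of polynomials. It is meaningful when each exponent vector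
  occurs in only finitely many members of the family, as is the case for \<open>lwc_M\<close> and \<open>lwc_F\<close>
  below at left weak compositions, because the last entry of these is positive.
\<close>

definition formal_sum :: "'i set \<Rightarrow> ('i \<Rightarrow> (nat \<Rightarrow>\<^sub>0 nat) \<Rightarrow>\<^sub>0 rat) \<Rightarrow> series" where
  "formal_sum I f =
     (\<lambda>m. \<Sum>n | n \<in> I \<and> Poly_Mapping.lookup (f n) m \<noteq> 0. Poly_Mapping.lookup (f n) m)"

definition lwc :: "nat list \<Rightarrow> bool" where
  "lwc \<gamma> \<longleftrightarrow> \<gamma> \<noteq> [] \<and> 0 < last \<gamma>"

definition composition_of :: "nat \<Rightarrow> nat list \<Rightarrow> bool" where
  "composition_of s b \<longleftrightarrow> b \<noteq> [] \<and> (\<forall>e\<in>set b. 0 < e) \<and> sum_list b = s"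

definition lwc_M :: "nat list \<Rightarrow> series" where
  "lwc_M \<gamma> = formal_sum
     {ns. length ns = length \<gamma> \<and> (\<forall>n\<in>set ns. 1 \<le> n) \<and> sorted_wrt (<) ns}
     (\<lambda>ns. \<Prod>p<length \<gamma>. var (ns ! p) ^ (\<gamma> ! p))"

definition LWCQSym :: "series set" where
  "LWCQSym = series.span (insert series_one (lwc_M ` {\<gamma>. lwc \<gamma>}))"

text \<open>
  The list \<open>[(i\<^sub>1, s\<^sub>1), \<dots>, (i\<^sub>k, s\<^sub>k)]\<close> encodes the sequence made of \<open>i\<^sub>1\<close> zeros, \<open>s\<^sub>1\<close>, \<open>\<dots>\<close>,
  \<open>i\<^sub>k\<close> zeros, \<open>s\<^sub>k\<close>. On left weak compositions \<open>blocks\<close> is inverse to this encoding.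
\<close>

definition unblocks :: "(nat \<times> nat) list \<Rightarrow> nat list" where
  "unblocks bl = concat (map (\<lambda>(i, s). replicate i 0 @ [s]) bl)"

fun blocks :: "nat list \<Rightarrow> (nat \<times> nat) list" where
  "blocks [] = []"
| "blocks (0 # \<gamma>) = (case blocks \<gamma> of [] \<Rightarrow> [] | (i, s) # bl \<Rightarrow> (Suc i, s) # bl)"
| "blocks (Suc n # \<gamma>) = (0, Suc n) # blocks \<gamma>"

lemma blocks_unblocks:
  assumes "\<forall>(i, s)\<in>set bl. 1 \<le> s"
  shows "blocks (unblocks bl) = bl"
  using assms
proof (induction bl)
  case Nil
  then show ?case by (simp add: unblocks_def)
next
  case (Cons b bl)
  obtain i n where b: "b = (i, Suc n)"
    using Cons.prems by (cases b, cases "snd b") auto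
  have "blocks (replicate i 0 @ Suc n # \<gamma>) = (i, Suc n) # blocks \<gamma>" for \<gamma>
    by (induction i) auto
  then show ?case
    using Cons b by (simp add: unblocks_def)
qed

lemma unblocks_blocks:
  assumes "lwc \<gamma>"
  shows "unblocks (blocks \<gamma>) = \<gamma>" "blocks \<gamma> \<noteq> []" "\<forall>(i, s)\<in>set (blocks \<gamma>). 1 \<le> s"
proof -
  have "unblocks (blocks \<gamma>) = \<gamma> \<and> blocks \<gamma> \<noteq> [] \<and> (\<forall>(i, s)\<in>set (blocks \<gamma>). 1 \<le> s)"
    using assms
  proof (induction \<gamma> rule: blocks.induct)
    case 1
    then show ?case by (simp add: lwc_def)
  next
    case (2 \<gamma>)
    then have "lwc \<gamma>" by (auto simp: lwc_def split: if_splits)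
    with 2 show ?case
      by (auto simp: unblocks_def split: list.splits)
  next
    case (3 n \<gamma>)
    then show ?case
      by (cases "\<gamma> = []") (auto simp: lwc_def unblocks_def)
  qed
  then show "unblocks (blocks \<gamma>) = \<gamma>" "blocks \<gamma> \<noteq> []" "\<forall>(i, s)\<in>set (blocks \<gamma>). 1 \<le> s"
    by auto
qed

text \<open>
  Blocks are numbered from \<open>0\<close>: \<open>zeros_at \<alpha> p\<close> is \<open>i\<close> and \<open>part_at \<alpha> p\<close> is \<open>s\<close> with index \<open>p + 1\<close>.
  The numbers \<open>a\<^sub>p\<close> keep their index, so \<open>block_end \<alpha> p\<close> is \<open>a\<^sub>p\<close>.
\<close>

definition zeros_at :: "nat list \<Rightarrow> nat \<Rightarrow> nat" where
  "zeros_at \<alpha> p = fst (blocks \<alpha> ! p)"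

definition part_at :: "nat list \<Rightarrow> nat \<Rightarrow> nat" where
  "part_at \<alpha> p = snd (blocks \<alpha> ! p)"

definition num_blocks :: "nat list \<Rightarrow> nat" where
  "num_blocks \<alpha> = length (blocks \<alpha>)"

definition block_end :: "nat list \<Rightarrow> nat \<Rightarrow> nat" where
  "block_end \<alpha> p = (\<Sum>q<p. zeros_at \<alpha> q + part_at \<alpha> q)"

text \<open>
  Since lists are indexed from \<open>0\<close>, the index written \<open>n\<^sub>t\<close> in the usual notation is \<open>ns ! (t - 1)\<close>.
\<close>

definition F_indices :: "nat list \<Rightarrow> nat list set" where
  "F_indices \<alpha> = {ns. length ns = block_end \<alpha> (num_blocks \<alpha>) \<and> (\<forall>n\<in>set ns. 1 \<le> n) \<and>
     (\<forall>t\<in>{1..<length ns}.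
        if t \<in> block_end \<alpha> ` {1..<num_blocks \<alpha>} then ns ! (t - 1) < ns ! t
        else ns ! (t - 1) \<le> ns ! t)}"

definition lwc_F :: "nat list \<Rightarrow> series" where
  "lwc_F \<alpha> = formal_sum (F_indices \<alpha>)
     (\<lambda>ns. \<Prod>p<num_blocks \<alpha>.
        (\<Prod>t\<in>{block_end \<alpha> p..<block_end \<alpha> p + zeros_at \<alpha> p}. var (ns ! t) ^ 0) *
        (\<Prod>t\<in>{block_end \<alpha> p + zeros_at \<alpha> p..<block_end \<alpha> (Suc p)}. var (ns ! t)))"

text \<open>
  \<open>\<beta>\<close> consists of \<open>j\<^sub>1\<close> zeros, a composition \<open>\<beta>\<^sub>1\<close> of \<open>s\<^sub>1\<close>, \<open>\<dots>\<close>, \<open>j\<^sub>k\<close> zeros, a composition \<open>\<beta>\<^sub>k\<close>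
  of \<open>s\<^sub>k\<close>, with \<open>j\<^sub>p \<le> i\<^sub>p\<close>; \<open>js\<close> lists the \<open>j\<^sub>p\<close> and \<open>bs\<close> the \<open>\<beta>\<^sub>p\<close>.
\<close>

definition block_refinement ::
  "nat list \<Rightarrow> nat list \<Rightarrow> nat list list \<Rightarrow> nat list \<Rightarrow> bool" where
  "block_refinement \<alpha> js bs \<beta> \<longleftrightarrow>
     length js = num_blocks \<alpha> \<and> length bs = num_blocks \<alpha> \<and>
     (\<forall>p<num_blocks \<alpha>. js ! p \<le> zeros_at \<alpha> p \<and> composition_of (part_at \<alpha> p) (bs ! p)) \<and>
     \<beta> = concat (map2 (\<lambda>j b. replicate j 0 @ b) js bs)"

definition lwc_le :: "nat list \<Rightarrow> nat list \<Rightarrow> bool" (infix "\<preceq>" 50) where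
  "\<beta> \<preceq> \<alpha> \<longleftrightarrow> lwc \<beta> \<and> lwc \<alpha> \<and> sum_list \<beta> = sum_list \<alpha> \<and>
     (\<exists>js bs. block_refinement \<alpha> js bs \<beta>)"

text \<open>
  For \<open>\<beta> \<preceq> \<alpha>\<close> the numbers \<open>j\<^sub>p\<close> are determined by \<open>\<alpha>\<close> and \<open>\<beta>\<close>, so the description is unique.
\<close>

definition lwc_coeff :: "nat list \<Rightarrow> nat list \<Rightarrow> nat" where
  "lwc_coeff \<alpha> \<beta> = (THE c. \<exists>js bs. block_refinement \<alpha> js bs \<beta> \<and>
     c = (\<Prod>p<num_blocks \<alpha>. zeros_at \<alpha> p choose (js ! p)))"

end

theory Submission
  imports Defs
begin

text \<open>
  Both families are sums over chains of indices, each step of which is required to be strict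
  (\<open><\<close>) or weak (\<open>\<le>\<close>). Splitting every weak step of \<open>F\<^sub>\<alpha>\<close> into \<open><\<close> and \<open>=\<close>, where an equality merges
  two letters by adding their exponents, turns \<open>F\<^sub>\<alpha>\<close> into a sum of \<open>M\<^sub>\<beta>\<close>. In a block \<open>(0\<^sup>i, 1\<^sup>s)\<close> the \<open>i\<close>
  steps following the zeros can be split so as to keep \<open>j\<close> zeros in \<open>i choose j\<close> ways, whereas the
  steps between the ones produce each composition of \<open>s\<close> exactly once.

  The coefficient of \<open>x\<^sub>1\<^bsup>\<delta>\<^sub>1\<^esup> \<cdots> x\<^sub>r\<^bsup>\<delta>\<^sub>r\<^esup>\<close> in \<open>M\<^sub>\<gamma>\<close> vanishes unless \<open>\<gamma> = \<delta>\<close> or \<open>\<gamma>\<close> is shorter than \<open>\<delta>\<close>, so the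
  \<open>M\<^sub>\<gamma>\<close> are independent. The expansion of \<open>F\<^sub>\<alpha>\<close> is unitriangular, so the \<open>F\<^sub>\<alpha>\<close> form a basis, too.
\<close>

section \<open>Formal sums and monomials\<close>

lemma sum_fun_apply: "(\<Sum>i\<in>S. f i) x = (\<Sum>i\<in>S. f i x)"
  for f :: "'i \<Rightarrow> 'a \<Rightarrow> 'b::comm_monoid_add"
  by (induction S rule: infinite_finite_induct) (auto simp: plus_fun_def zero_fun_def)

lemma formal_sum_single:
  assumes "\<And>n. n \<in> I \<Longrightarrow> f n = Poly_Mapping.single (e n) 1"
  shows "formal_sum I f m = of_nat (card {n \<in> I. e n = m})"
proof -
  have "{n. n \<in> I \<and> Poly_Mapping.lookup (f n) m \<noteq> 0} = {n \<in> I. e n = m}"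
    using assms by (auto simp: lookup_single when_def split: if_splits)
  moreover have "Poly_Mapping.lookup (f n) m = 1" if "n \<in> {n \<in> I. e n = m}" for n
    using that assms by (auto simp: lookup_single)
  ultimately show ?thesis
    by (simp add: formal_sum_def)
qed

lemma formal_sum_cong:
  assumes "\<And>n. n \<in> I \<Longrightarrow> f n = g n" "I = J"
  shows "formal_sum I f = formal_sum J g"
  unfolding formal_sum_def assms(2)[symmetric]
  by (rule ext, rule sum.cong) (auto simp: assms(1))

text \<open>A \<open>sum\<close> over an infinite set has the default value 0, so additivity relies
  on each \<open>m\<close> occurring in only finitely many members.\<close>

lemma formal_sum_Un_disjoint:
  assumes "I \<inter> J = {}"
    and "\<And>m. finite {n \<in> I \<union> J. Poly_Mapping.lookup (f n) m \<noteq> 0}"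
  shows "formal_sum (I \<union> J) f = formal_sum I f + formal_sum J f"
proof
  fix m
  let ?A = "\<lambda>I. {n. n \<in> I \<and> Poly_Mapping.lookup (f n) m \<noteq> 0}"
  have *: "?A (I \<union> J) = ?A I \<union> ?A J" by auto
  then have "finite (?A I)" "finite (?A J)"
    using assms(2)[of m] by auto
  then show "formal_sum (I \<union> J) f m = (formal_sum I f + formal_sum J f) m"
    unfolding formal_sum_def plus_fun_def * using assms(1)
    by (intro sum.union_disjoint) auto
qed

lemma formal_sum_reindex:
  assumes "inj_on h I"
  shows "formal_sum (h ` I) f = formal_sum I (f \<circ> h)"
proof
  fix m
  have *: "{n. n \<in> h ` I \<and> Poly_Mapping.lookup (f n) m \<noteq> 0} =
        h ` {n. n \<in> I \<and> Poly_Mapping.lookup (f (h n)) m \<noteq> 0}" by auto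
  have "inj_on h {n. n \<in> I \<and> Poly_Mapping.lookup (f (h n)) m \<noteq> 0}"
    using assms by (rule inj_on_subset) auto
  then show "formal_sum (h ` I) f m = formal_sum I (f \<circ> h) m"
    unfolding formal_sum_def * by (simp add: sum.reindex)
qed

lemma var_power: "var n ^ e = Poly_Mapping.single (Poly_Mapping.single n e) 1"
  by (induction e) (simp_all add: var_def mult_single single_add[symmetric])

lemma prod_single:
  "(\<Prod>t\<in>A. Poly_Mapping.single (e t) (1::'b::comm_semiring_1)) =
     Poly_Mapping.single (\<Sum>t\<in>A. e t) 1"
  for e :: "'i \<Rightarrow> 'a::comm_monoid_add"
  by (induction A rule: infinite_finite_induct) (simp_all add: mult_single)

section \<open>Series of weakly and strictly increasing chains\<close>

text \<open>
  A letter \<open>(e, f)\<close> of a word asks for an index carrying exponent \<open>e\<close>; the flag \<open>f\<close> tells whether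
  this index must be strictly greater than the preceding one. Starting from \<open>N = 0\<close> with a
  strict first letter forces all indices to be at least \<open>1\<close>.
\<close>

fun chain :: "nat \<Rightarrow> (nat \<times> bool) list \<Rightarrow> nat list \<Rightarrow> bool" where
  "chain N [] ns \<longleftrightarrow> ns = []"
| "chain N (a # w) [] \<longleftrightarrow> False"
| "chain N (a # w) (n # ns) \<longleftrightarrow> (if snd a then N < n else N \<le> n) \<and> chain n w ns"

definition chain_monom :: "(nat \<times> bool) list \<Rightarrow> nat list \<Rightarrow> (nat \<Rightarrow>\<^sub>0 nat) \<Rightarrow>\<^sub>0 rat" where
  "chain_monom w ns = (\<Prod>t<length w. var (ns ! t) ^ fst (w ! t))"

definition chain_series :: "(nat \<times> bool) list \<Rightarrow> series" where
  "chain_series w = formal_sum {ns. chain 0 w ns} (chain_monom w)"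

abbreviation strict :: "nat list \<Rightarrow> (nat \<times> bool) list" where
  "strict \<equiv> map (\<lambda>e. (e, True))"

abbreviation weak :: "nat list \<Rightarrow> (nat \<times> bool) list" where
  "weak \<equiv> map (\<lambda>e. (e, False))"

lemma chain_length: "chain N w ns \<Longrightarrow> length ns = length w"
  by (induction N w ns rule: chain.induct) auto

lemma chain_sorted: "chain N w ns \<Longrightarrow> sorted (N # ns)"
  by (induction N w ns rule: chain.induct) (auto split: if_splits)

lemma chain_append:
  "length xs = length u \<Longrightarrow> chain N (u @ w) (xs @ ys) \<longleftrightarrow> chain N u xs \<and> chain (last (N # xs)) w ys"
  by (induction N u xs rule: chain.induct) auto

text \<open>Links the recursion to the positionwise description in \<open>F_indices\<close>: the
  predecessor of \<open>ns ! t\<close> is \<open>(N # ns) ! t\<close>, where \<open>N\<close> stands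
  before the first index.\<close>

lemma chain_nth_iff:
  "chain N w ns \<longleftrightarrow> length ns = length w \<and>
     (\<forall>t<length w. if snd (w ! t) then (N # ns) ! t < ns ! t else (N # ns) ! t \<le> ns ! t)"
proof (induction N w ns rule: chain.induct)
  case (3 N a w n ns)
  show ?case
    unfolding chain.simps 3 by (simp add: All_less_Suc2) blast
qed auto

lemma chain_strict_iff: "chain N (strict \<gamma>) ns \<longleftrightarrow> length ns = length \<gamma> \<and> sorted_wrt (<) (N # ns)"
proof (induction \<gamma> arbitrary: N ns)
  case (Cons e \<gamma>)
  then show ?case
    by (cases ns) (auto simp del: sorted_wrt.simps(2) simp: sorted_wrt2 intro: sorted_wrt1)
qed auto

lemma chain_monom_Cons: "chain_monom (a # w) (n # ns) = var n ^ fst a * chain_monom w ns"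
  unfolding chain_monom_def by (simp add: prod.lessThan_Suc_shift del: prod.lessThan_Suc)

lemma chain_monom_append:
  "length xs = length u \<Longrightarrow> chain_monom (u @ w) (xs @ ys) = chain_monom u xs * chain_monom w ys"
proof (induction u arbitrary: xs)
  case (Cons a u)
  then show ?case
    by (cases xs) (auto simp: chain_monom_Cons mult.assoc)
qed (simp add: chain_monom_def)

lemma chain_monom_single:
  "chain_monom w ns =
     Poly_Mapping.single (\<Sum>t<length w. Poly_Mapping.single (ns ! t) (fst (w ! t))) 1"
  unfolding chain_monom_def var_power by (rule prod_single)

lemma lookup_chain_monom_nonzero_iff:
  "Poly_Mapping.lookup (chain_monom w ns) m \<noteq> 0 \<longleftrightarrow>
     (\<Sum>t<length w. Poly_Mapping.single (ns ! t) (fst (w ! t))) = m"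
  by (simp add: chain_monom_single lookup_single when_def)

text \<open>The last letter contributes a positive exponent to its index, and natural exponents at
  the same index cannot cancel.\<close>

lemma chain_last_in_keys:
  assumes "chain N w ns" "w \<noteq> []" "0 < fst (last w)"
  shows "last ns \<in> Poly_Mapping.keys (\<Sum>t<length w. Poly_Mapping.single (ns ! t) (fst (w ! t)))"
proof -
  have len: "length ns = length w" using assms(1) by (rule chain_length)
  let ?t = "length w - 1"
  have "ns \<noteq> []" using len assms(2) by auto
  then have l: "last ns = ns ! ?t" by (simp add: last_conv_nth len)
  have "0 < fst (w ! ?t)" using assms by (simp add: last_conv_nth)
  then show ?thesis
    using assms(2) by (auto simp: in_keys_iff lookup_sum l intro!: bexI[of _ ?t])
qed

text \<open>By the positive last exponent the last index is a variable of \<open>m\<close>. It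
  bounds all earlier ones, so the chains lie among the lists of fixed length over a bounded
  range.\<close>

lemma finite_chains:
  assumes "w = [] \<or> 0 < fst (last w)"
  shows "finite {ns. chain N w ns \<and> Poly_Mapping.lookup (chain_monom w ns) m \<noteq> 0}"
proof (cases "w = []")
  case False
  have "{ns. chain N w ns \<and> Poly_Mapping.lookup (chain_monom w ns) m \<noteq> 0} \<subseteq>
      {ns. set ns \<subseteq> {..Max (Poly_Mapping.keys m)} \<and> length ns = length w}"
  proof safe
    fix ns n
    assume ns: "chain N w ns" "Poly_Mapping.lookup (chain_monom w ns) m \<noteq> 0"
    then show "length ns = length w" by (simp add: chain_length)
    assume n: "n \<in> set ns"
    have "last ns \<in> Poly_Mapping.keys m"
      using chain_last_in_keys[OF ns(1) False] assms False ns(2)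
      by (simp add: lookup_chain_monom_nonzero_iff)
    then have "last ns \<le> Max (Poly_Mapping.keys m)" by simp
    moreover have "n \<le> last ns"
    proof -
      have "sorted ns" using chain_sorted[OF ns(1)] by simp
      moreover have "ns = butlast ns @ [last ns]" using n by (cases ns) auto
      ultimately show ?thesis using n
        by (metis Un_iff empty_iff empty_set list.set_intros(1) order_refl set_ConsD set_append
              sorted_append)
    qed
    ultimately show "n \<le> Max (Poly_Mapping.keys m)" by simp
  qed
  then show ?thesis
    by (rule finite_subset) (rule finite_lists_length_eq, simp)
qed simp

text \<open>A weak inequality is either strict or an equality, and in the latter case the exponents add.\<close>

lemma chain_series_split:
  assumes "0 < fst (last ((d, False) # v))"
  shows "chain_series (u @ (e, f) # (d, False) # v) =
     chain_series (u @ (e, f) # (d, True) # v) + chain_series (u @ (e + d, f) # v)"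
proof -
  let ?w = "u @ (e, f) # (d, False) # v"
  let ?S = "\<lambda>w. {ns. chain 0 w ns}"
  \<comment> \<open>\<open>h\<close> repeats the index at position \<open>length u\<close>. It maps
    the chains of the merged word onto those chains of \<open>?w\<close> whose split step is an
    equality.\<close>
  define h :: "nat list \<Rightarrow> nat list"
    where "h = (\<lambda>ns. take (Suc (length u)) ns @ drop (length u) ns)"
  have h: "h (xs @ n # ys) = xs @ n # n # ys" if "length xs = length u" for xs n ys
    using that by (simp add: h_def)
  have decomp1: "\<exists>xs n ys. ns = xs @ n # ys \<and> length xs = length u"
    if "ns \<in> ?S (u @ (e + d, f) # v)" for ns
  proof -
    have "length u < length ns" using that chain_length by fastforce
    then show ?thesis
      using id_take_nth_drop[of "length u" ns] by force
  qed
  have decomp2: "\<exists>xs n n' ys. ns = xs @ n # n' # ys \<and> length xs = length u"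
    if "ns \<in> ?S (u @ (e, f) # (d, g) # v)" for ns g
  proof -
    have *: "Suc (length u) < length ns" using that chain_length by fastforce
    then have "ns = take (length u) ns @ ns ! length u # ns ! Suc (length u) #
        drop (Suc (Suc (length u))) ns"
      by (metis Cons_nth_drop_Suc Suc_lessD append_take_drop_id)
    with * show ?thesis
      by (metis Suc_lessD length_take min.absorb4)
  qed
  have union: "?S ?w = ?S (u @ (e, f) # (d, True) # v) \<union> h ` ?S (u @ (e + d, f) # v)"
  proof (intro equalityI subsetI)
    fix ns assume ns: "ns \<in> ?S ?w"
    obtain xs n n' ys where x: "ns = xs @ n # n' # ys" "length xs = length u"
      using decomp2[OF ns] by blast
    show "ns \<in> ?S (u @ (e, f) # (d, True) # v) \<union> h ` ?S (u @ (e + d, f) # v)"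
    proof (cases "n = n'")
      case True
      with ns x have "xs @ n # ys \<in> ?S (u @ (e + d, f) # v)"
        by (auto simp: chain_append)
      moreover have "h (xs @ n # ys) = ns" using x True h by simp
      ultimately show ?thesis by blast
    next
      case False
      with ns x show ?thesis by (auto simp: chain_append)
    qed
  next
    fix ns assume "ns \<in> ?S (u @ (e, f) # (d, True) # v) \<union> h ` ?S (u @ (e + d, f) # v)"
    then consider "ns \<in> ?S (u @ (e, f) # (d, True) # v)"
      | ns' where "ns' \<in> ?S (u @ (e + d, f) # v)" "ns = h ns'" by blast
    then show "ns \<in> ?S ?w"
    proof cases
      case 1
      with decomp2[OF this] show ?thesis by (auto simp: chain_append)
    next
      case 2
      with decomp1[OF 2(1)] show ?thesis by (auto simp: chain_append h)
    qed
  qed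
  \<comment> \<open>Chains in the first set increase at the split step, those in the image repeat an
    index there.\<close>
  have disj: "?S (u @ (e, f) # (d, True) # v) \<inter> h ` ?S (u @ (e + d, f) # v) = {}"
  proof -
    have "h ns' \<notin> ?S (u @ (e, f) # (d, True) # v)" if "ns' \<in> ?S (u @ (e + d, f) # v)" for ns'
      using decomp1[OF that] by (auto simp: chain_append h)
    then show ?thesis by blast
  qed
  have inj: "inj_on h (?S (u @ (e + d, f) # v))"
  proof (rule inj_onI)
    fix a b assume ab: "a \<in> ?S (u @ (e + d, f) # v)" "b \<in> ?S (u @ (e + d, f) # v)" "h a = h b"
    then show "a = b"
      using decomp1[OF ab(1)] decomp1[OF ab(2)] by (auto simp: h)
  qed
  have "chain_series ?w = formal_sum (?S (u @ (e, f) # (d, True) # v)) (chain_monom ?w) +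
      formal_sum (h ` ?S (u @ (e + d, f) # v)) (chain_monom ?w)"
    unfolding chain_series_def union
    using finite_chains[of ?w 0] assms
    by (intro formal_sum_Un_disjoint[OF disj]) (simp add: union[symmetric] del: Un_iff)
  also have "formal_sum (?S (u @ (e, f) # (d, True) # v)) (chain_monom ?w) =
      chain_series (u @ (e, f) # (d, True) # v)"
    unfolding chain_series_def
  proof (rule formal_sum_cong)
    fix ns assume "ns \<in> ?S (u @ (e, f) # (d, True) # v)"
    then show "chain_monom ?w ns = chain_monom (u @ (e, f) # (d, True) # v) ns"
      using decomp2 by (force simp: chain_monom_append chain_monom_Cons)
  qed simp
  \<comment> \<open>The repeated index contributes
    \<open>var n ^ e * var n ^ d = var n ^ (e + d)\<close>, as the merged letter does.\<close>
  also have "formal_sum (h ` ?S (u @ (e + d, f) # v)) (chain_monom ?w) =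
      chain_series (u @ (e + d, f) # v)"
    unfolding chain_series_def formal_sum_reindex[OF inj]
  proof (rule formal_sum_cong)
    fix ns assume "ns \<in> ?S (u @ (e + d, f) # v)"
    then show "(chain_monom ?w \<circ> h) ns = chain_monom (u @ (e + d, f) # v) ns"
      using decomp1 by (force simp: h chain_monom_append chain_monom_Cons power_add mult.assoc)
  qed simp
  finally show ?thesis .
qed

section \<open>Monomial and fundamental functions as chain series\<close>

lemma lwc_M_eq_chain_series: "lwc_M \<gamma> = chain_series (strict \<gamma>)"
  unfolding lwc_M_def chain_series_def
  by (rule formal_sum_cong) (auto simp: chain_strict_iff chain_monom_def Suc_le_eq)

text \<open>The strict first letter is the strict inequality between a block and its predecessor. In
  the first block it becomes the bound \<open>1 \<le> n\<close>, as chains start from 0.\<close>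

definition block_word :: "nat \<Rightarrow> nat \<Rightarrow> (nat \<times> bool) list" where
  "block_word i s = map (\<lambda>q. (if q < i then 0 else 1, q = 0)) [0..<i + s]"

definition word :: "(nat \<times> nat) list \<Rightarrow> (nat \<times> bool) list" where
  "word bl = concat (map (\<lambda>(i, s). block_word i s) bl)"

lemma block_word_0: "block_word 0 (Suc s) = (1, True) # weak (replicate s 1)"
  unfolding block_word_def
  by (intro nth_equalityI) (auto simp: nth_Cons' simp del: upt_Suc)

lemma block_word_Suc:
  "block_word (Suc i) (Suc s) = (0, True) # weak (replicate i 0 @ [1]) @ weak (replicate s 1)"
  unfolding block_word_def
  by (intro nth_equalityI) (auto simp: nth_Cons' nth_append simp del: upt_Suc)

lemma nth_concat_sum:
  "p < length xss \<Longrightarrow> r < length (xss ! p) \<Longrightarrow>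
     concat xss ! ((\<Sum>q<p. length (xss ! q)) + r) = xss ! p ! r"
proof (induction xss arbitrary: p)
  case (Cons xs xss)
  show ?case
  proof (cases p)
    case 0
    with Cons.prems show ?thesis by (simp add: nth_append)
  next
    case (Suc p')
    with Cons show ?thesis by (simp add: sum.lessThan_Suc_shift nth_append add.assoc del: sum.lessThan_Suc)
  qed
qed simp

lemma length_block_word [simp]: "length (block_word i s) = i + s"
  by (simp add: block_word_def)

lemma block_end_Suc: "block_end \<alpha> (Suc p) = block_end \<alpha> p + zeros_at \<alpha> p + part_at \<alpha> p"
  by (simp add: block_end_def)

lemma block_end_mono: "p \<le> p' \<Longrightarrow> block_end \<alpha> p \<le> block_end \<alpha> p'"
  unfolding block_end_def by (rule sum_mono2) auto

lemma part_at_pos: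
  assumes "lwc \<alpha>" "p < num_blocks \<alpha>"
  shows "0 < part_at \<alpha> p"
  using unblocks_blocks(3)[OF assms(1)] assms(2) nth_mem[of p "blocks \<alpha>"]
  by (fastforce simp: part_at_def num_blocks_def)

lemma length_word: "length (word (blocks \<alpha>)) = block_end \<alpha> (num_blocks \<alpha>)"
  unfolding word_def block_end_def length_concat num_blocks_def
  by (auto simp: sum_list_sum_nth atLeast0LessThan case_prod_unfold zeros_at_def part_at_def intro!: sum.cong)

lemma word_nth:
  assumes "p < num_blocks \<alpha>" "r < zeros_at \<alpha> p + part_at \<alpha> p"
  shows "word (blocks \<alpha>) ! (block_end \<alpha> p + r) = (if r < zeros_at \<alpha> p then 0 else 1, r = 0)"
proof -
  have len: "length (map (\<lambda>(i, s). block_word i s) (blocks \<alpha>) ! q) = zeros_at \<alpha> q + part_at \<alpha> q"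
    if "q < num_blocks \<alpha>" for q
    using that by (simp add: num_blocks_def case_prod_unfold zeros_at_def part_at_def)
  have "block_end \<alpha> p = (\<Sum>q<p. length (map (\<lambda>(i, s). block_word i s) (blocks \<alpha>) ! q))"
    unfolding block_end_def using assms(1) by (intro sum.cong) (auto simp: len)
  then have "word (blocks \<alpha>) ! (block_end \<alpha> p + r) = map (\<lambda>(i, s). block_word i s) (blocks \<alpha>) ! p ! r"
    using nth_concat_sum[of p "map (\<lambda>(i, s). block_word i s) (blocks \<alpha>)" r] assms len[OF assms(1)]
    by (simp add: word_def num_blocks_def)
  also have "\<dots> = (if r < zeros_at \<alpha> p then 0 else 1, r = 0)"
    using assms by (simp add: num_blocks_def block_word_def case_prod_unfold zeros_at_def part_at_def)
  finally show ?thesis .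
qed

lemma obtain_block:
  assumes "t < block_end \<alpha> k"
  obtains p r where "p < k" "r < zeros_at \<alpha> p + part_at \<alpha> p" "t = block_end \<alpha> p + r"
  using assms
proof (induction k arbitrary: thesis)
  case (Suc k)
  show ?case
  proof (cases "t < block_end \<alpha> k")
    case True
    with Suc show ?thesis by (metis less_SucI)
  next
    case False
    with Suc.prems show ?thesis
      by (intro Suc.prems(1)[of k "t - block_end \<alpha> k"]) (auto simp: block_end_Suc)
  qed
qed (simp add: block_end_def)

lemma prod_blocks:
  "(\<Prod>p<k. \<Prod>t\<in>{block_end \<alpha> p..<block_end \<alpha> (Suc p)}. g t) = (\<Prod>t<block_end \<alpha> k. g t)"
  for g :: "nat \<Rightarrow> 'a::comm_monoid_mult"
proof (induction k)
  case (Suc k)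
  then show ?case
    using prod.atLeastLessThan_concat[of 0 "block_end \<alpha> k" "block_end \<alpha> (Suc k)" g]
      block_end_mono[of k "Suc k" \<alpha>]
    by (simp add: atLeast0LessThan)
qed (simp add: block_end_def)

text \<open>Strict letters stand at the block starts: those of later blocks are the strict positions
  of \<open>F_indices\<close>, and position 0 accounts for indices being at least 1. The exponents 0
  and 1 of the letters reproduce the two products of each block.\<close>

lemma lwc_F_eq_chain_series:
  assumes "\<alpha> = [] \<or> lwc \<alpha>"
  shows "lwc_F \<alpha> = chain_series (word (blocks \<alpha>))"
  unfolding lwc_F_def chain_series_def
proof (rule formal_sum_cong)
  let ?w = "word (blocks \<alpha>)" and ?k = "num_blocks \<alpha>"
  have flag: "snd (?w ! t) \<longleftrightarrow> t = 0 \<or> t \<in> block_end \<alpha> ` {1..<?k}" if t: "t < length ?w" for t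
  proof -
    obtain p r where p: "p < ?k" "r < zeros_at \<alpha> p + part_at \<alpha> p" "t = block_end \<alpha> p + r"
      using t obtain_block by (metis length_word)
    have "lwc \<alpha>" using assms p(1) by (auto simp: num_blocks_def)
    \<comment> \<open>Parts are positive, so \<open>block_end\<close> increases strictly. Hence a
      block start \<open>t\<close> determines its block and has offset 0.\<close>
    have *: "r = 0 \<and> q = p" if q: "q < ?k" "t = block_end \<alpha> q" for q
    proof -
      have "block_end \<alpha> q < block_end \<alpha> (Suc q)"
        using part_at_pos[OF \<open>lwc \<alpha>\<close> q(1)] by (simp add: block_end_Suc)
      moreover have "t < block_end \<alpha> (Suc p)" using p by (simp add: block_end_Suc)
      ultimately have "\<not> Suc q \<le> p" "\<not> Suc p \<le> q"
        using p(3) q(2) block_end_mono[of "Suc q" p \<alpha>] block_end_mono[of "Suc p" q \<alpha>] by linarith+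
      then have "q = p" by simp
      then show ?thesis using p q by auto
    qed
    \<comment> \<open>The start of block 0 is \<open>t = 0\<close>, which the index range
      \<open>{1..<?k}\<close> leaves out.\<close>
    have "block_end \<alpha> 0 = 0" by (simp add: block_end_def)
    then have "r = 0 \<longleftrightarrow> t = 0 \<or> t \<in> block_end \<alpha> ` {1..<?k}"
      using p * by (cases "p = 0") force+
    then show ?thesis using word_nth[OF p(1,2)] p(3) by simp
  qed
  have "chain 0 ?w ns" if ns: "ns \<in> F_indices \<alpha>" for ns
    unfolding chain_nth_iff
  proof (intro conjI allI impI)
    show l: "length ns = length ?w" using ns by (simp add: F_indices_def length_word)
    fix t assume t: "t < length ?w"
    show "if snd (?w ! t) then (0 # ns) ! t < ns ! t else (0 # ns) ! t \<le> ns ! t"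
    proof (cases "t = 0")
      case True
      then have "1 \<le> ns ! t" using ns t l by (auto simp: F_indices_def)
      with True show ?thesis by simp
    next
      case False
      then have "t \<in> {1..<length ns}" using t l by simp
      with ns have "if t \<in> block_end \<alpha> ` {1..<?k} then ns ! (t - 1) < ns ! t
        else ns ! (t - 1) \<le> ns ! t"
        unfolding F_indices_def by blast
      with False flag[OF t] show ?thesis by (simp add: nth_Cons' split: if_splits)
    qed
  qed
  moreover have "ns \<in> F_indices \<alpha>" if c: "chain 0 ?w ns" for ns
    unfolding F_indices_def
  proof (intro CollectI conjI ballI)
    show l: "length ns = block_end \<alpha> ?k" using chain_length[OF c] by (simp add: length_word)
    have *: "if snd (?w ! t) then (0 # ns) ! t < ns ! t else (0 # ns) ! t \<le> ns ! t"
      if "t < length ns" for t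
      using c that unfolding chain_nth_iff by auto
    {
      fix n assume n: "n \<in> set ns"
      then have "0 < length ns" by (cases ns) auto
      then have "0 < ns ! 0" using *[of 0] flag[of 0] l by (simp add: length_word)
      moreover have "ns ! 0 \<le> n"
        using chain_sorted[OF c] n by (cases ns) auto
      ultimately show "1 \<le> n" by simp
    }
    fix t assume "t \<in> {1..<length ns}"
    then show "if t \<in> block_end \<alpha> ` {1..<?k} then ns ! (t - 1) < ns ! t
        else ns ! (t - 1) \<le> ns ! t"
      using *[of t] flag[of t] l by (simp add: nth_Cons' length_word split: if_splits)
  qed
  ultimately show "F_indices \<alpha> = {ns. chain 0 ?w ns}" by blast
  fix ns
  let ?g = "\<lambda>t. var (ns ! t) ^ fst (?w ! t)"
  have "(\<Prod>t\<in>{block_end \<alpha> p..<block_end \<alpha> p + zeros_at \<alpha> p}. var (ns ! t) ^ 0) *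
        (\<Prod>t\<in>{block_end \<alpha> p + zeros_at \<alpha> p..<block_end \<alpha> (Suc p)}. var (ns ! t)) =
        (\<Prod>t\<in>{block_end \<alpha> p..<block_end \<alpha> (Suc p)}. ?g t)" if p: "p < ?k" for p
  proof -
    have g: "?g t = (if t < block_end \<alpha> p + zeros_at \<alpha> p then var (ns ! t) ^ 0 else var (ns ! t))"
      if "t \<in> {block_end \<alpha> p..<block_end \<alpha> (Suc p)}" for t
      using word_nth[OF p, of "t - block_end \<alpha> p"] that by (auto simp: block_end_Suc)
    have "(\<Prod>t\<in>{block_end \<alpha> p..<block_end \<alpha> (Suc p)}. ?g t) =
        (\<Prod>t\<in>{block_end \<alpha> p..<block_end \<alpha> p + zeros_at \<alpha> p}. ?g t) *
        (\<Prod>t\<in>{block_end \<alpha> p + zeros_at \<alpha> p..<block_end \<alpha> (Suc p)}. ?g t)"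
      by (rule prod.atLeastLessThan_concat[symmetric]) (auto simp: block_end_Suc)
    also have "\<dots> = (\<Prod>t\<in>{block_end \<alpha> p..<block_end \<alpha> p + zeros_at \<alpha> p}. var (ns ! t) ^ 0) *
        (\<Prod>t\<in>{block_end \<alpha> p + zeros_at \<alpha> p..<block_end \<alpha> (Suc p)}. var (ns ! t))"
      by (intro arg_cong2[where f = "(*)"] prod.cong refl) (auto simp: g block_end_Suc)
    finally show ?thesis by simp
  qed
  then show "(\<Prod>p<?k. (\<Prod>t\<in>{block_end \<alpha> p..<block_end \<alpha> p + zeros_at \<alpha> p}. var (ns ! t) ^ 0) *
        (\<Prod>t\<in>{block_end \<alpha> p + zeros_at \<alpha> p..<block_end \<alpha> (Suc p)}. var (ns ! t))) =
        chain_monom ?w ns"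
    unfolding chain_monom_def length_word prod_blocks[symmetric]
    by (intro prod.cong) auto
qed

section \<open>Expansion of the fundamental functions\<close>

text \<open>Pascal's rule under the sum. It solves the recursion for zeros, in which a zero is
  either kept, shifting \<open>X\<close>, or merged away.\<close>

lemma (in vector_space) sum_scale_binomial_Suc:
  "(\<Sum>j\<le>Suc n. of_nat (Suc n choose j) *s X j) =
     (\<Sum>j\<le>n. of_nat (n choose j) *s X (Suc j)) + (\<Sum>j\<le>n. of_nat (n choose j) *s X j)"
proof -
  have "(\<Sum>j\<le>Suc n. of_nat (Suc n choose j) *s X j) =
      (\<Sum>j\<le>n. of_nat (n choose j) *s X (Suc j)) +
      (X 0 + (\<Sum>j\<le>n. of_nat (n choose Suc j) *s X (Suc j)))"
    by (simp add: sum.atMost_Suc_shift scale_left_distrib sum.distrib algebra_simps del: sum.atMost_Suc)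
  also have "X 0 + (\<Sum>j\<le>n. of_nat (n choose Suc j) *s X (Suc j)) =
      (\<Sum>j\<le>Suc n. of_nat (n choose j) *s X j)"
    by (simp add: sum.atMost_Suc_shift del: sum.atMost_Suc)
  finally show ?thesis by (simp add: binomial_eq_0)
qed

text \<open>Split the step after the first zero: a strict step moves this zero into the prefix for
  good, an equality merges it with the next letter. Two zeros merge into one since
  \<open>0 + 0 = 0\<close>, so the recursion is Pascal's. The induction varies
  \<open>\<gamma>\<close>, which collects the zeros kept.\<close>

lemma chain_series_zeros:
  assumes "v = [] \<or> 0 < fst (last v)"
  shows "chain_series (strict (\<gamma> @ [0]) @ weak (replicate i 0 @ [1]) @ v) =
    (\<Sum>j\<le>Suc i. series_scale (of_nat (Suc i choose j))
       (chain_series (strict (\<gamma> @ replicate j 0 @ [1]) @ v)))"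
proof (induction i arbitrary: \<gamma>)
  case 0
  have "0 < fst (last ((1, False) # v))" using assms by auto
  \<comment> \<open>The merged word is the term \<open>j = 0\<close>, which comes first in the sum;
    hence the commutation.\<close>
  from trans[OF chain_series_split[OF this, of "strict \<gamma>" 0 True] add.commute]
  show ?case by simp
next
  case (Suc i)
  have "0 < fst (last ((0, False) # weak (replicate i 0 @ [1]) @ v))" using assms by auto
  then have "chain_series (strict (\<gamma> @ [0]) @ weak (replicate (Suc i) 0 @ [1]) @ v) =
      chain_series (strict ((\<gamma> @ [0]) @ [0]) @ weak (replicate i 0 @ [1]) @ v) +
      chain_series (strict (\<gamma> @ [0]) @ weak (replicate i 0 @ [1]) @ v)"
    using chain_series_split[of 0 "weak (replicate i 0 @ [1]) @ v" "strict \<gamma>" 0 True]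
    by simp
  also have "\<dots> = (\<Sum>j\<le>Suc (Suc i). series_scale (of_nat (Suc (Suc i) choose j))
       (chain_series (strict (\<gamma> @ replicate j 0 @ [1]) @ v)))"
    unfolding Suc series.sum_scale_binomial_Suc[of "Suc i"] by simp
  finally show ?case .
qed

lemma compositions_hd_0: "1 \<le> e \<Longrightarrow> {b. composition_of e b \<and> e \<le> hd b} = {[e]}"
  by (auto simp: composition_of_def neq_Nil_conv)
    (metis add_eq_self_zero hd_in_set le_add1 le_antisym list.exhaust not_gr_zero sum_list_eq_0_iff)

text \<open>A head equal to \<open>e\<close> leaves a composition of \<open>Suc s\<close>, nonempty
  since its sum is positive; any other head is at least \<open>Suc e\<close>. The two cases mirror
  the two outcomes of splitting a step between ones.\<close>

lemma compositions_hd_Suc: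
  assumes "1 \<le> e"
  shows "{b. composition_of (e + Suc s) b \<and> e \<le> hd b} =
    (#) e ` {b. composition_of (1 + s) b \<and> 1 \<le> hd b} \<union>
    {b. composition_of (Suc e + s) b \<and> Suc e \<le> hd b}" (is "?L = ?A \<union> ?B")
proof (intro equalityI subsetI)
  fix b assume b: "b \<in> ?L"
  then obtain x y where "b = x # y" by (cases b) (auto simp: composition_of_def)
  with b show "b \<in> ?A \<union> ?B"
    by (cases "x = e"; cases y) (auto simp: composition_of_def)
qed (use assms in \<open>auto simp: composition_of_def\<close>)

lemma finite_compositions_hd: "1 \<le> e \<Longrightarrow> finite {b. composition_of (e + s) b \<and> e \<le> hd b}"
proof (induction s arbitrary: e)
  case 0
  then show ?case by (simp add: compositions_hd_0)
next
  case (Suc s)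
  show ?case
    unfolding compositions_hd_Suc[OF Suc.prems]
    by (intro finite_UnI finite_imageI Suc.IH) auto
qed

lemma compositions_hd_1:
  "{b. composition_of (1 + s) b \<and> 1 \<le> hd b} = {b. composition_of (Suc s) b}"
  by (auto simp: composition_of_def Suc_le_eq)

lemma finite_compositions: "0 < s \<Longrightarrow> finite {b. composition_of s b}"
  using finite_compositions_hd[of 1 "s - 1"] unfolding compositions_hd_1 by simp

text \<open>The strict letter \<open>e\<close> is a part under construction: a strict step closes it
  and opens a new part 1, an equality enlarges it to \<open>Suc e\<close>. Since it can only grow,
  the compositions reached have head at least \<open>e\<close>.\<close>

lemma chain_series_ones_hd:
  assumes "v = [] \<or> 0 < fst (last v)" "1 \<le> e"
  shows "chain_series (strict (\<gamma> @ [e]) @ weak (replicate s 1) @ v) =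
    (\<Sum>b | composition_of (e + s) b \<and> e \<le> hd b. chain_series (strict (\<gamma> @ b) @ v))"
  using assms(2)
proof (induction s arbitrary: \<gamma> e)
  case 0
  then show ?case by (simp add: compositions_hd_0)
next
  case (Suc s)
  let ?C = "\<lambda>e s. {b. composition_of (e + s) b \<and> e \<le> hd b}"
  have "0 < fst (last ((1, False) # weak (replicate s 1) @ v))"
    using assms(1) by (cases "v = []"; cases s) auto
  then have "chain_series (strict (\<gamma> @ [e]) @ weak (replicate (Suc s) 1) @ v) =
      chain_series (strict ((\<gamma> @ [e]) @ [1]) @ weak (replicate s 1) @ v) +
      chain_series (strict (\<gamma> @ [Suc e]) @ weak (replicate s 1) @ v)"
    using chain_series_split[of 1 "weak (replicate s 1) @ v" "strict \<gamma>" e True]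
    by simp
  also have "\<dots> = (\<Sum>b\<in>(#) e ` ?C 1 s. chain_series (strict (\<gamma> @ b) @ v)) +
      (\<Sum>b\<in>?C (Suc e) s. chain_series (strict (\<gamma> @ b) @ v))"
    using Suc.IH[of 1 "\<gamma> @ [e]"] Suc.IH[of "Suc e" \<gamma>] by (simp add: sum.reindex)
  also have "\<dots> = (\<Sum>b\<in>?C e (Suc s). chain_series (strict (\<gamma> @ b) @ v))"
    unfolding compositions_hd_Suc[OF Suc.prems]
    by (intro sum.union_disjoint[symmetric] finite_imageI finite_compositions_hd) auto
  finally show ?case .
qed

lemma chain_series_ones:
  assumes "v = [] \<or> 0 < fst (last v)"
  shows "chain_series (strict (\<gamma> @ [1]) @ weak (replicate s 1) @ v) =
    (\<Sum>b | composition_of (Suc s) b. chain_series (strict (\<gamma> @ b) @ v))"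
  using chain_series_ones_hd[OF assms, of 1 \<gamma> s] unfolding compositions_hd_1 by simp

text \<open>The zeros are resolved first, with the weak ones left in the tail; then the ones are
  grouped into compositions.\<close>

lemma chain_series_block:
  assumes "v = [] \<or> 0 < fst (last v)" "0 < s"
  shows "chain_series (strict \<gamma> @ block_word i s @ v) =
    (\<Sum>j\<le>i. \<Sum>b | composition_of s b. series_scale (of_nat (i choose j))
       (chain_series (strict (\<gamma> @ replicate j 0 @ b) @ v)))"
proof -
  obtain s' where s: "s = Suc s'" using assms(2) by (cases s) auto
  have "chain_series (strict \<gamma> @ block_word i s @ v) =
      (\<Sum>j\<le>i. series_scale (of_nat (i choose j))
        (chain_series (strict ((\<gamma> @ replicate j 0) @ [1]) @ weak (replicate s' 1) @ v)))"
  proof (cases i)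
    \<comment> \<open>Without zeros the block starts with its strict one, and only
      \<open>j = 0\<close> remains.\<close>
    case 0
    then show ?thesis by (simp add: s block_word_0)
  next
    case (Suc i')
    have "weak (replicate s' 1) @ v = [] \<or> 0 < fst (last (weak (replicate s' 1) @ v))"
      using assms(1) by (cases "v = []"; cases s') auto
    from chain_series_zeros[OF this, of \<gamma> i'] show ?thesis
      by (simp add: s Suc block_word_Suc del: sum.atMost_Suc binomial_Suc_Suc)
  qed
  also have "\<dots> = (\<Sum>j\<le>i. \<Sum>b | composition_of s b. series_scale (of_nat (i choose j))
       (chain_series (strict (\<gamma> @ replicate j 0 @ b) @ v)))"
    unfolding chain_series_ones[OF assms(1)] s series.scale_sum_right by simp
  finally show ?thesis .
qed

text \<open>
  The outcome of the splittings in a block \<open>(i, s)\<close> is a pair \<open>(j, b)\<close>: \<open>j\<close> zeros remain, and the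
  ones group into the composition \<open>b\<close>; \<open>weight\<close> counts the splittings with a given outcome.
\<close>

definition choices :: "(nat \<times> nat) list \<Rightarrow> (nat \<times> nat list) list set" where
  "choices bl = {c. list_all2 (\<lambda>(i, s) (j, b). j \<le> i \<and> composition_of s b) bl c}"

definition flatten :: "(nat \<times> nat list) list \<Rightarrow> nat list" where
  "flatten c = concat (map (\<lambda>(j, b). replicate j 0 @ b) c)"

definition weight :: "(nat \<times> nat) list \<Rightarrow> (nat \<times> nat list) list \<Rightarrow> nat" where
  "weight bl c = (\<Prod>p<length bl. fst (bl ! p) choose fst (c ! p))"

lemma flatten_Nil [simp]: "flatten [] = []"
  by (simp add: flatten_def)

lemma flatten_Cons [simp]: "flatten ((j, b) # c) = replicate j 0 @ b @ flatten c"
  by (simp add: flatten_def)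

lemma weight_Nil [simp]: "weight [] c = 1"
  by (simp add: weight_def)

lemma weight_Cons [simp]: "weight ((i, s) # bl) ((j, b) # c) = (i choose j) * weight bl c"
  unfolding weight_def by (simp add: prod.lessThan_Suc_shift del: prod.lessThan_Suc)

lemma choices_Nil [simp]: "choices [] = {[]}"
  by (simp add: choices_def)

lemma choices_Cons:
  "choices ((i, s) # bl) =
     (\<lambda>(j, b, c). (j, b) # c) ` ({..i} \<times> {b. composition_of s b} \<times> choices bl)"
  by (force simp: choices_def list_all2_Cons1)

lemma finite_choices: "\<forall>(i, s)\<in>set bl. 1 \<le> s \<Longrightarrow> finite (choices bl)"
  by (induction bl) (auto simp: choices_Cons finite_compositions)

text \<open>Every block ends in a letter of exponent 1. This provides the positive last exponent on
  which the splittings rely for finiteness.\<close>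

lemma last_word_pos:
  assumes "\<forall>(i, s)\<in>set bl. 1 \<le> s"
  shows "word bl = [] \<or> 0 < fst (last (word bl))"
proof (cases bl rule: rev_cases)
  case (snoc bl' x)
  obtain i s where x: "x = (i, s)" by fastforce
  have "1 \<le> s" using assms snoc x by simp
  then have "fst (last (block_word i s)) = 1" "block_word i s \<noteq> []"
    by (auto simp: block_word_def last_map)
  then show ?thesis by (simp add: snoc x word_def)
qed (simp add: word_def)

text \<open>Blocks are resolved from left to right. The prefix \<open>\<gamma>\<close> holds the
  letters already made strict, so that a single \<open>lwc_M\<close> remains when no block is
  left.\<close>

lemma chain_series_word:
  assumes "\<forall>(i, s)\<in>set bl. 1 \<le> s"
  shows "chain_series (strict \<gamma> @ word bl) =
    (\<Sum>c\<in>choices bl. series_scale (of_nat (weight bl c)) (lwc_M (\<gamma> @ flatten c)))"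
  using assms
proof (induction bl arbitrary: \<gamma>)
  case Nil
  show ?case by (simp add: word_def lwc_M_eq_chain_series)
next
  case (Cons x bl)
  obtain i s where x: "x = (i, s)" by fastforce
  have s: "0 < s" and bl: "\<forall>(i, s)\<in>set bl. 1 \<le> s" using Cons.prems x by auto
  have w: "word (x # bl) = block_word i s @ word bl" by (simp add: word_def x)
  have inj: "inj_on (\<lambda>(j, b, c). (j, b) # c)
      ({..i} \<times> {b. composition_of s b} \<times> choices bl)"
    by (auto simp: inj_on_def)
  have "chain_series (strict \<gamma> @ word (x # bl)) =
    (\<Sum>j\<le>i. \<Sum>b | composition_of s b. \<Sum>c\<in>choices bl.
       series_scale (of_nat (weight (x # bl) ((j, b) # c)))
       (lwc_M (\<gamma> @ flatten ((j, b) # c))))"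
    unfolding w chain_series_block[OF last_word_pos[OF bl] s] Cons.IH[OF bl] series.scale_sum_right
    by (simp add: x)
  also have "\<dots> = (\<Sum>c\<in>choices (x # bl).
      series_scale (of_nat (weight (x # bl) c)) (lwc_M (\<gamma> @ flatten c)))"
    unfolding x choices_Cons sum.reindex[OF inj]
    by (simp add: sum.cartesian_product case_prod_unfold)
  finally show ?case .
qed

section \<open>Uniqueness of refinements and the coefficients\<close>

lemma takeWhile_zeros_composition:
  assumes "composition_of s b"
  shows "takeWhile (\<lambda>e. e = 0) (replicate j 0 @ b @ r) = replicate j 0"
proof -
  obtain x b' where "b = x # b'" "x > 0"
    using assms by (cases b) (auto simp: composition_of_def)
  then show ?thesis by (simp add: takeWhile_append)
qed

text \<open>One of the two compositions is a prefix of the other; surplus entries would be positive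
  and push the sum beyond \<open>s\<close>.\<close>

lemma composition_append_eq:
  assumes "b @ r = b' @ r'" "composition_of s b" "composition_of s b'"
  shows "b = b' \<and> r = r'"
proof -
  have aux: "us = []" if "composition_of s (d @ us)" "composition_of s d" for d us
    using that by (cases us) (auto simp: composition_of_def)
  from assms(1) obtain us where "b = b' @ us \<and> us @ r = r' \<or> b @ us = b' \<and> r = us @ r'"
    by (auto simp: append_eq_append_conv2)
  with aux[of b us] aux[of b' us] assms(2,3) show ?thesis by auto
qed

text \<open>A composition starts with a positive entry, so the number of leading zeros recovers
  \<open>j\<close>.\<close>

lemma zeros_composition_append_eq:
  assumes "replicate j 0 @ b @ r = replicate j' 0 @ b' @ r'" "composition_of s b" "composition_of s b'"
  shows "j = j' \<and> b = b' \<and> r = r'"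
proof -
  have "j = j'"
    using arg_cong[OF assms(1), of "\<lambda>xs. length (takeWhile (\<lambda>e. e = 0) xs)"]
    by (simp only: length_replicate takeWhile_zeros_composition[OF assms(2)]
        takeWhile_zeros_composition[OF assms(3)])
  then show ?thesis using assms(1) composition_append_eq[OF _ assms(2,3)] by simp
qed

text \<open>The sums \<open>s\<close> prescribed by \<open>bl\<close> tell where each composition
  ends, so a flattened list can be parsed block by block.\<close>

lemma flatten_inj: "inj_on flatten (choices bl)"
proof (induction bl)
  case (Cons x bl)
  obtain i s where x: "x = (i, s)" by fastforce
  show ?case
  proof (rule inj_onI)
    fix c c' assume c: "c \<in> choices (x # bl)" "c' \<in> choices (x # bl)" "flatten c = flatten c'"
    from c(1,2) obtain j b r j' b' r' where *: "c = (j, b) # r" "c' = (j', b') # r'"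
      "composition_of s b" "composition_of s b'" "r \<in> choices bl" "r' \<in> choices bl"
      by (auto simp: x choices_Cons)
    have "replicate j 0 @ b @ flatten r = replicate j' 0 @ b' @ flatten r'"
      using c(3) *(1,2) by simp
    from zeros_composition_append_eq[OF this *(3,4)] inj_onD[OF Cons.IH _ *(5,6)] show "c = c'"
      using *(1,2) by simp
  qed
qed simp

lemma block_refinement_iff:
  "block_refinement \<alpha> js bs \<beta> \<longleftrightarrow> length js = length bs \<and>
     zip js bs \<in> choices (blocks \<alpha>) \<and> \<beta> = flatten (zip js bs)"
  by (auto simp: block_refinement_def choices_def flatten_def list_all2_conv_all_nth
      num_blocks_def zeros_at_def part_at_def case_prod_unfold)

text \<open>The predicate \<open>P\<close> allows two uses: a trivial \<open>P\<close> describes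
  \<open>\<preceq>\<close>, and the product formula as \<open>P\<close> gives the body of
  \<open>lwc_coeff\<close>.\<close>

lemma ex_block_refinement_iff:
  "(\<exists>js bs. block_refinement \<alpha> js bs \<beta> \<and> P js bs) \<longleftrightarrow>
     (\<exists>c\<in>choices (blocks \<alpha>). \<beta> = flatten c \<and> P (map fst c) (map snd c))"
proof
  assume "\<exists>js bs. block_refinement \<alpha> js bs \<beta> \<and> P js bs"
  then show "\<exists>c\<in>choices (blocks \<alpha>). \<beta> = flatten c \<and> P (map fst c) (map snd c)"
    by (metis block_refinement_iff map_fst_zip map_snd_zip)
next
  assume "\<exists>c\<in>choices (blocks \<alpha>). \<beta> = flatten c \<and> P (map fst c) (map snd c)"
  then show "\<exists>js bs. block_refinement \<alpha> js bs \<beta> \<and> P js bs"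
    by (metis block_refinement_iff length_map zip_map_fst_snd)
qed

lemma length_choices: "c \<in> choices bl \<Longrightarrow> length c = length bl"
  by (auto simp: choices_def list_all2_lengthD)

lemma weight_eq:
  assumes "c \<in> choices (blocks \<alpha>)"
  shows "(\<Prod>p<num_blocks \<alpha>. zeros_at \<alpha> p choose (map fst c ! p)) = weight (blocks \<alpha>) c"
  using length_choices[OF assms]
  by (auto simp: weight_def num_blocks_def zeros_at_def intro!: prod.cong)

text \<open>Injectivity of \<open>flatten\<close> gives the uniqueness demanded by
  \<open>THE\<close>.\<close>

lemma lwc_coeff_flatten:
  assumes "c \<in> choices (blocks \<alpha>)"
  shows "lwc_coeff \<alpha> (flatten c) = weight (blocks \<alpha>) c"
  unfolding lwc_coeff_def ex_block_refinement_iff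
proof (rule the_equality)
  show "\<exists>c'\<in>choices (blocks \<alpha>). flatten c = flatten c' \<and>
      weight (blocks \<alpha>) c = (\<Prod>p<num_blocks \<alpha>. zeros_at \<alpha> p choose (map fst c' ! p))"
    using assms weight_eq by metis
  fix k assume "\<exists>c'\<in>choices (blocks \<alpha>). flatten c = flatten c' \<and>
      k = (\<Prod>p<num_blocks \<alpha>. zeros_at \<alpha> p choose (map fst c' ! p))"
  then show "k = weight (blocks \<alpha>) c"
    using flatten_inj[of "blocks \<alpha>"] assms weight_eq by (metis inj_onD)
qed

lemma lwc_coeff_block_refinement:
  assumes "block_refinement \<alpha> js bs \<beta>"
  shows "lwc_coeff \<alpha> \<beta> = (\<Prod>p<num_blocks \<alpha>. zeros_at \<alpha> p choose (js ! p))"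
  using assms lwc_coeff_flatten[of "zip js bs" \<alpha>] weight_eq[of "zip js bs" \<alpha>]
  unfolding block_refinement_iff by simp

lemma flatten_choices:
  assumes "c \<in> choices bl" "bl \<noteq> []"
  shows "lwc (flatten c)" "sum_list (flatten c) = sum_list (unblocks bl)"
proof -
  \<comment> \<open>The implication serves the induction: its base case flattens to
    \<open>[]\<close>, which is not \<open>lwc\<close>.\<close>
  have "(bl \<noteq> [] \<longrightarrow> lwc (flatten c)) \<and> sum_list (flatten c) = sum_list (unblocks bl)"
    using assms(1)
  proof (induction bl arbitrary: c)
    case (Cons x bl)
    obtain i s where x: "x = (i, s)" by fastforce
    from Cons.prems obtain j b r where *: "c = (j, b) # r" "composition_of s b" "r \<in> choices bl"
      by (auto simp: x choices_Cons)
    show ?case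
      using * Cons.IH[OF *(3)]
      by (cases "bl = []") (auto simp: x unblocks_def lwc_def composition_of_def sum_list_replicate)
  qed (simp add: unblocks_def)
  with assms(2) show "lwc (flatten c)" "sum_list (flatten c) = sum_list (unblocks bl)" by auto
qed

lemma lwc_le_iff: "lwc \<alpha> \<Longrightarrow> \<beta> \<preceq> \<alpha> \<longleftrightarrow> \<beta> \<in> flatten ` choices (blocks \<alpha>)"
  using flatten_choices[of _ "blocks \<alpha>"] unblocks_blocks[of \<alpha>]
    ex_block_refinement_iff[of \<alpha> \<beta> "\<lambda>_ _. True"]
  unfolding lwc_le_def by auto

lemma finite_lwc_le: "lwc \<alpha> \<Longrightarrow> finite {\<beta>. \<beta> \<preceq> \<alpha>}"
  by (simp add: lwc_le_iff) (intro finite_imageI finite_choices unblocks_blocks(3))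

text \<open>Resolve the word of \<open>\<alpha>\<close> from an empty prefix; injectivity of
  \<open>flatten\<close> turns the sum over choices into a sum over \<open>\<beta>\<close>.\<close>

lemma lwc_F_expansion:
  assumes "lwc \<alpha>"
  shows "lwc_F \<alpha> = (\<Sum>\<beta> | \<beta> \<preceq> \<alpha>. series_scale (of_nat (lwc_coeff \<alpha> \<beta>)) (lwc_M \<beta>))"
proof -
  have "{\<beta>. \<beta> \<preceq> \<alpha>} = flatten ` choices (blocks \<alpha>)"
    using lwc_le_iff[OF assms] by auto
  then show ?thesis
    using chain_series_word[of "blocks \<alpha>" "[]"] unblocks_blocks(3)[OF assms]
      lwc_F_eq_chain_series[of \<alpha>] assms
    by (simp add: sum.reindex[OF flatten_inj] lwc_coeff_flatten)
qed

section \<open>The diagonal coefficient and a rank for the order\<close>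

lemma choices_self:
  assumes "\<forall>(i, s)\<in>set bl. 1 \<le> s"
  shows "\<exists>c\<in>choices bl. flatten c = unblocks bl \<and> weight bl c = 1"
  using assms
proof (induction bl)
  case (Cons x bl)
  obtain i s where x: "x = (i, s)" by fastforce
  from Cons obtain c where c: "c \<in> choices bl" "flatten c = unblocks bl" "weight bl c = 1" by auto
  \<comment> \<open>The witness keeps all \<open>i\<close> zeros and leaves \<open>s\<close> in one
    part, so its binomial is \<open>i choose i = 1\<close>.\<close>
  have "composition_of s [s]" using Cons.prems x by (auto simp: composition_of_def)
  with c show ?case
    by (intro bexI[of _ "(i, [s]) # c"]) (auto simp: x choices_Cons unblocks_def image_iff)
qed (simp add: unblocks_def)

lemma lwc_le_refl: "lwc \<alpha> \<Longrightarrow> \<alpha> \<preceq> \<alpha>"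
  and lwc_coeff_self: "lwc \<alpha> \<Longrightarrow> lwc_coeff \<alpha> \<alpha> = 1"
  using choices_self[of "blocks \<alpha>"] unblocks_blocks[of \<alpha>] lwc_coeff_flatten[of _ \<alpha>]
  by (auto simp: lwc_le_iff image_iff)

text \<open>
  Splitting a part raises the number of nonzero entries, and deleting a zero lowers the number of
  zeros; either way the size minus the number of nonzero entries plus the number of zeros drops.
\<close>

definition coarseness :: "nat list \<Rightarrow> nat" where
  "coarseness \<gamma> = (\<Sum>e\<leftarrow>\<gamma>. if e = 0 then 1 else e - 1)"

lemma coarseness_Nil [simp]: "coarseness [] = 0"
  by (simp add: coarseness_def)

lemma coarseness_Cons [simp]:
  "coarseness (e # \<gamma>) = (if e = 0 then 1 else e - 1) + coarseness \<gamma>"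
  by (simp add: coarseness_def)

lemma coarseness_append [simp]: "coarseness (xs @ ys) = coarseness xs + coarseness ys"
  by (simp add: coarseness_def)

lemma coarseness_replicate_0 [simp]: "coarseness (replicate n 0) = n"
  by (induction n) auto

lemma coarseness_positive: "\<forall>e\<in>set b. 0 < e \<Longrightarrow> coarseness b + length b = sum_list b"
  by (induction b) auto

text \<open>For positive entries the coarseness is \<open>s - length b\<close>, which is largest for
  a single part.\<close>

lemma coarseness_composition:
  assumes "composition_of s b"
  shows "coarseness b \<le> s - 1" "s - 1 \<le> coarseness b \<Longrightarrow> b = [s]"
proof -
  have b: "coarseness b + length b = s" "b \<noteq> []"
    using assms coarseness_positive[of b] by (auto simp: composition_of_def)
  then have l: "1 \<le> length b" by (cases b) auto
  with b show "coarseness b \<le> s - 1" by simp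
  assume "s - 1 \<le> coarseness b"
  with b l have "length b = 1" by linarith
  then show "b = [s]" using assms by (auto simp: composition_of_def length_Suc_conv)
qed

text \<open>In each block \<open>j \<le> i\<close> and \<open>coarseness b \<le> s - 1\<close>;
  equal totals force equality in every one of these bounds.\<close>

lemma coarseness_flatten:
  assumes "c \<in> choices bl" "\<forall>(i, s)\<in>set bl. 1 \<le> s"
  shows "coarseness (flatten c) \<le> coarseness (unblocks bl) \<and>
     (coarseness (flatten c) = coarseness (unblocks bl) \<longrightarrow> flatten c = unblocks bl)"
  using assms
proof (induction bl arbitrary: c)
  case (Cons x bl)
  obtain i s where x: "x = (i, s)" by fastforce
  from Cons.prems obtain j b r where *: "c = (j, b) # r" "composition_of s b" "r \<in> choices bl" "j \<le> i"
    by (auto simp: x choices_Cons)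
  have IH: "coarseness (flatten r) \<le> coarseness (unblocks bl)"
      "coarseness (flatten r) = coarseness (unblocks bl) \<longrightarrow> flatten r = unblocks bl"
    using Cons.IH[OF *(3)] Cons.prems by auto
  have u: "unblocks (x # bl) = replicate i 0 @ [s] @ unblocks bl"
    by (simp add: x unblocks_def)
  have "1 \<le> s" using Cons.prems x by auto
  then have cu: "coarseness (unblocks (x # bl)) = i + (s - 1) + coarseness (unblocks bl)"
    unfolding u by simp
  have cc: "coarseness (flatten c) = j + coarseness b + coarseness (flatten r)"
    unfolding *(1) by simp
  note b = coarseness_composition[OF *(2)]
  show ?case
  proof (intro conjI impI)
    show "coarseness (flatten c) \<le> coarseness (unblocks (x # bl))"
      using cu cc b(1) IH(1) *(4) by linarith
    assume "coarseness (flatten c) = coarseness (unblocks (x # bl))"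
    with cu cc b(1) IH(1) *(4) have "j = i" "s - 1 \<le> coarseness b"
      "coarseness (flatten r) = coarseness (unblocks bl)" by linarith+
    then show "flatten c = unblocks (x # bl)"
      using b(2) IH(2) by (simp add: *(1) u)
  qed
qed (simp add: unblocks_def)

lemma coarseness_lwc_le:
  assumes "\<beta> \<preceq> \<alpha>" "\<beta> \<noteq> \<alpha>"
  shows "coarseness \<beta> < coarseness \<alpha>"
proof -
  have "lwc \<alpha>" using assms(1) by (simp add: lwc_le_def)
  then show ?thesis
    using assms coarseness_flatten[of _ "blocks \<alpha>"] unblocks_blocks[of \<alpha>] lwc_le_iff[of \<alpha> \<beta>]
    by (auto simp: le_less)
qed

section \<open>Independence of the monomial functions\<close>

lemma lwc_M_lookup: "lwc_M \<gamma> m = of_nat (card {ns. chain 0 (strict \<gamma>) ns \<and>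
    (\<Sum>t<length \<gamma>. Poly_Mapping.single (ns ! t) (\<gamma> ! t)) = m})"
  unfolding lwc_M_eq_chain_series chain_series_def
  by (subst formal_sum_single[OF chain_monom_single]) (auto simp: intro!: arg_cong[where f = card])

text \<open>The test monomial for \<open>\<gamma>\<close>: its exponents occupy the first variables
  without gaps, shifted by \<open>Suc\<close> because variables are numbered from 1.\<close>

definition packed_monom :: "nat list \<Rightarrow> nat \<Rightarrow>\<^sub>0 nat" where
  "packed_monom \<gamma> = (\<Sum>t<length \<gamma>. Poly_Mapping.single (Suc t) (\<gamma> ! t))"

lemma lookup_packed_monom:
  "Poly_Mapping.lookup (packed_monom \<gamma>) (Suc t) = (if t < length \<gamma> then \<gamma> ! t else 0)"
  unfolding packed_monom_def lookup_sum
  by (simp add: lookup_single when_def sum.delta' cong: if_cong)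

lemma keys_packed_monom: "Poly_Mapping.keys (packed_monom \<gamma>) \<subseteq> {1..length \<gamma>}"
proof
  fix n assume "n \<in> Poly_Mapping.keys (packed_monom \<gamma>)"
  then show "n \<in> {1..length \<gamma>}"
    by (cases n) (auto simp: in_keys_iff lookup_packed_monom split: if_splits,
        auto simp: packed_monom_def lookup_sum lookup_single)
qed

text \<open>The coefficient counts chains, among them \<open>1, ..., length \<gamma>\<close>.
  Finiteness matters, since \<open>card\<close> is 0 on infinite sets.\<close>

lemma lwc_M_packed_monom_self:
  assumes "\<gamma> = [] \<or> lwc \<gamma>"
  shows "lwc_M \<gamma> (packed_monom \<gamma>) \<noteq> 0"
proof -
  let ?A = "{ns. chain 0 (strict \<gamma>) ns \<and>
    (\<Sum>t<length \<gamma>. Poly_Mapping.single (ns ! t) (\<gamma> ! t)) = packed_monom \<gamma>}"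
  have "sorted_wrt (<) (0 # map Suc [0..<length \<gamma>])"
    by (auto simp: sorted_wrt_map)
  then have mem: "map Suc [0..<length \<gamma>] \<in> ?A"
    by (auto simp: chain_strict_iff packed_monom_def simp del: map_Suc_upt)
  have fin: "finite ?A"
    using finite_chains[of "strict \<gamma>" 0 "packed_monom \<gamma>"] assms
    by (cases "\<gamma> = []") (simp_all add: lookup_chain_monom_nonzero_iff lwc_def last_map)
  have "card ?A \<noteq> 0"
  proof
    assume "card ?A = 0"
    with fin have "?A = {}" by (rule card_0_eq[THEN iffD1])
    from mem[unfolded this] show False by (rule emptyE)
  qed
  then show ?thesis unfolding lwc_M_lookup of_nat_eq_0_iff .
qed

text \<open>The last index carries a positive exponent, so all indices lie in
  \<open>{1..length \<delta>}\<close>; being distinct, there are at most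
  \<open>length \<delta>\<close> of them. If there are that many, they are exactly
  \<open>1, ..., length \<delta>\<close>, and comparing exponents gives
  \<open>\<gamma> = \<delta>\<close>.\<close>

lemma lwc_M_packed_monom:
  assumes "\<gamma> = [] \<or> lwc \<gamma>" "lwc_M \<gamma> (packed_monom \<delta>) \<noteq> 0" "\<delta> = [] \<or> lwc \<delta>"
  shows "\<gamma> = \<delta> \<or> length \<gamma> < length \<delta>"
proof (cases "\<gamma> = []")
  case False
  then have lwc: "lwc \<gamma>" using assms(1) by simp
  have "\<exists>ns. chain 0 (strict \<gamma>) ns \<and>
      (\<Sum>t<length \<gamma>. Poly_Mapping.single (ns ! t) (\<gamma> ! t)) = packed_monom \<delta>"
    using assms(2) by (auto simp: lwc_M_lookup card_gt_0_iff)
  then obtain ns where ns: "chain 0 (strict \<gamma>) ns"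
    "(\<Sum>t<length \<gamma>. Poly_Mapping.single (ns ! t) (\<gamma> ! t)) = packed_monom \<delta>" by blast
  have len: "length ns = length \<gamma>" and sorted: "sorted_wrt (<) (0 # ns)"
    using ns(1) by (auto simp: chain_strict_iff)
  have "last ns \<in> Poly_Mapping.keys (packed_monom \<delta>)"
    using chain_last_in_keys[OF ns(1)] lwc ns(2) by (simp add: lwc_def last_map)
  then have "last ns \<le> length \<delta>" using keys_packed_monom[of \<delta>] by auto
  then have sub: "set ns \<subseteq> {1..length \<delta>}"
    using sorted by (induction ns rule: rev_induct) (fastforce simp: sorted_wrt_append)+
  have sd: "sorted ns" "distinct ns"
    using sorted by (simp_all add: strict_sorted_iff)
  then have card: "card (set ns) = length \<gamma>" by (simp add: distinct_card len)
  show ?thesis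
  proof (cases "length \<gamma> < length \<delta>")
    case False
    with card card_mono[OF _ sub] have eq: "length \<gamma> = length \<delta>" by simp
    then have "set ns = set [1..<Suc (length \<delta>)]"
      using card_subset_eq[OF _ sub] card by (simp add: atLeastLessThanSuc_atLeastAtMost del: upt_Suc)
    then have "ns = [1..<Suc (length \<delta>)]"
      using sd by (intro sorted_distinct_set_unique) (auto simp del: upt_Suc)
    then have "packed_monom \<gamma> = packed_monom \<delta>"
      using ns(2) eq by (simp add: packed_monom_def[of \<gamma>] del: upt_Suc)
    then have "\<gamma> ! t = \<delta> ! t" if "t < length \<gamma>" for t
      using that eq lookup_packed_monom[of \<gamma> t] lookup_packed_monom[of \<delta> t] by simp
    with eq show ?thesis by (simp add: nth_equalityI)
  qed simp
qed (use assms in auto)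

section \<open>Unitriangular changes of basis\<close>

text \<open>The empty list indexes the constant: \<open>lwc_M []\<close> and \<open>lwc_F []\<close>
  are both \<open>series_one\<close>.\<close>

definition indices :: "nat list set" where
  "indices = insert [] {\<gamma>. lwc \<gamma>}"

context vector_space
begin

text \<open>Independence of a set does not see repetitions in the family, hence the separate
  injectivity: a repeated vector would give a relation with coefficients 1 and -1.\<close>

lemma independent_family:
  assumes "\<And>S a. finite S \<Longrightarrow> S \<subseteq> I \<Longrightarrow> (\<Sum>x\<in>S. a x *s b x) = 0 \<Longrightarrow> \<forall>x\<in>S. a x = 0"
  shows "inj_on b I" "independent (b ` I)"
proof -
  show inj: "inj_on b I"
  proof (rule inj_onI, rule ccontr)
    fix x y assume xy: "x \<in> I" "y \<in> I" "b x = b y" "x \<noteq> y"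
    then have "(\<Sum>z\<in>{x, y}. (if z = x then 1 else - 1) *s b z) = 0" by simp
    with assms[of "{x, y}" "\<lambda>z. if z = x then 1 else - 1"] xy show False by auto
  qed
  show "independent (b ` I)"
    unfolding dependent_explicit
  proof safe
    fix T u v assume T: "finite T" "T \<subseteq> b ` I" "(\<Sum>v\<in>T. u v *s v) = 0" "v \<in> T" "u v \<noteq> 0"
    from T(1,2) obtain S where S: "S \<subseteq> I" "finite S" "T = b ` S"
      by (meson finite_subset_image)
    have "inj_on b S" using inj S(1) by (rule inj_on_subset)
    then have "(\<Sum>x\<in>S. u (b x) *s b x) = 0" using T(3) by (simp add: S(3) sum.reindex)
    with assms[OF S(2,1), of "\<lambda>x. u (b x)"] T(4,5) S(3) show False by auto
  qed
qed

text \<open>The way back from sets to families: \<open>the_inv_into\<close> carries the coefficients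
  from indices to vectors.\<close>

lemma independent_family_scale_sum:
  assumes "inj_on b I" "independent (b ` I)" "finite S" "S \<subseteq> I" "(\<Sum>x\<in>S. a x *s b x) = 0" "x \<in> S"
  shows "a x = 0"
proof -
  have inj: "inj_on b S" using assms(1,4) by (rule inj_on_subset)
  have "(\<Sum>v\<in>b ` S. a (the_inv_into S b v) *s v) = 0"
    using assms(5) by (simp add: sum.reindex[OF inj] the_inv_into_f_f[OF inj] cong: sum.cong)
  moreover have "independent (b ` S)"
    using independent_mono[OF assms(2)] assms(4) by blast
  ultimately have "a (the_inv_into S b (b x)) = 0"
    using assms(3,6) by (intro independentD[of "b ` S" "b ` S"]) auto
  then show ?thesis by (simp add: the_inv_into_f_f[OF inj assms(6)])
qed

context
  fixes I :: "'i set" and b f :: "'i \<Rightarrow> 'b" and D :: "'i \<Rightarrow> 'i set"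
    and c :: "'i \<Rightarrow> 'i \<Rightarrow> 'a" and \<mu> :: "'i \<Rightarrow> nat"
  assumes D: "\<And>x. x \<in> I \<Longrightarrow> finite (D x)" "\<And>x. x \<in> I \<Longrightarrow> D x \<subseteq> I" "\<And>x. x \<in> I \<Longrightarrow> x \<in> D x"
    and f: "\<And>x. x \<in> I \<Longrightarrow> f x = (\<Sum>y\<in>D x. c x y *s b y)"
    and c_self: "\<And>x. x \<in> I \<Longrightarrow> c x x = 1"
    and \<mu>: "\<And>x y. x \<in> I \<Longrightarrow> y \<in> D x \<Longrightarrow> y \<noteq> x \<Longrightarrow> \<mu> y < \<mu> x"
begin

text \<open>As \<open>c x x = 1\<close>, the expansion of \<open>f x\<close> can be solved for
  \<open>b x\<close>; strong induction on the rank \<open>\<mu>\<close> handles the remaining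
  terms.\<close>

lemma unitriangular_span: "span (f ` I) = span (b ` I)"
proof (rule span_eq[THEN iffD2], intro conjI subsetI)
  fix v assume "v \<in> f ` I"
  then obtain x where x: "v = f x" "x \<in> I" by blast
  have "(\<Sum>y\<in>D x. c x y *s b y) \<in> span (b ` I)"
    using D(2)[OF x(2)] by (intro span_sum span_scale span_base) auto
  then show "v \<in> span (b ` I)" using f[OF x(2)] x(1) by simp
next
  fix v assume "v \<in> b ` I"
  then obtain x where "v = b x" "x \<in> I" by blast
  moreover have "b x \<in> span (f ` I)" if "x \<in> I" for x
    using that
  proof (induction "\<mu> x" arbitrary: x rule: less_induct)
    case less
    have "f x = b x + (\<Sum>y\<in>D x - {x}. c x y *s b y)"
      using f[OF less.prems] D(1,3)[OF less.prems] c_self[OF less.prems]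
      by (simp add: sum.remove[of "D x" x])
    then have "b x = f x - (\<Sum>y\<in>D x - {x}. c x y *s b y)" by simp
    moreover have "(\<Sum>y\<in>D x - {x}. c x y *s b y) \<in> span (f ` I)"
    proof (intro span_sum span_scale)
      fix y assume "y \<in> D x - {x}"
      then show "b y \<in> span (f ` I)"
        using less.hyps[of y] \<mu>[OF less.prems, of y] D(2)[OF less.prems] by auto
    qed
    ultimately show ?case
      using span_diff[OF span_base[OF imageI[OF less.prems]]] by simp
  qed
  ultimately show "v \<in> span (f ` I)" by blast
qed

text \<open>In a relation among the \<open>f z\<close>, take \<open>x\<close> of largest rank with
  nonzero coefficient. No other term that occurs involves \<open>b x\<close>, so comparing
  coefficients of \<open>b x\<close> gives \<open>a x = 0\<close>.\<close>

lemma unitriangular_independent: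
  assumes "inj_on b I" "independent (b ` I)"
  shows "inj_on f I" "independent (f ` I)"
proof -
  have "\<forall>x\<in>S. a x = 0" if S: "finite S" "S \<subseteq> I" "(\<Sum>x\<in>S. a x *s f x) = 0" for S a
  proof (rule ccontr)
    define S' where "S' = {x \<in> S. a x \<noteq> 0}"
    assume "\<not> (\<forall>x\<in>S. a x = 0)"
    then have "S' \<noteq> {}" "finite S'" using S(1) by (auto simp: S'_def)
    then have "Max (\<mu> ` S') \<in> \<mu> ` S'" "\<And>y. y \<in> S' \<Longrightarrow> \<mu> y \<le> Max (\<mu> ` S')" by simp_all
    then obtain x where x: "x \<in> S'" "\<And>y. y \<in> S' \<Longrightarrow> \<mu> y \<le> \<mu> x" by auto
    have xS: "x \<in> S" "x \<in> I" using x(1) S(2) by (auto simp: S'_def)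
    \<comment> \<open>A common finite support for all \<open>f z\<close>, so that the two sums can
      be exchanged.\<close>
    define T where "T = (\<Union>x\<in>S. D x)"
    have T: "finite T" "T \<subseteq> I" "\<And>x. x \<in> S \<Longrightarrow> D x \<subseteq> T"
      using S(1,2) D(1,2) by (auto simp: T_def)
    have xT: "x \<in> T" using D(3)[OF xS(2)] xS(1) by (auto simp: T_def)
    let ?c = "\<lambda>z y. if y \<in> D z then c z y else 0"
    have "f z = (\<Sum>y\<in>T. ?c z y *s b y)" if z: "z \<in> S" for z
    proof -
      have "f z = (\<Sum>y\<in>D z. ?c z y *s b y)" using f z S(2) by auto
      also have "\<dots> = (\<Sum>y\<in>T. ?c z y *s b y)"
        using T(1,3) z by (intro sum.mono_neutral_left) auto
      finally show ?thesis .
    qed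
    then have "(\<Sum>z\<in>S. a z *s f z) = (\<Sum>z\<in>S. \<Sum>y\<in>T. (a z * ?c z y) *s b y)"
      by (simp add: scale_sum_right cong: sum.cong)
    also have "\<dots> = (\<Sum>y\<in>T. (\<Sum>z\<in>S. a z * ?c z y) *s b y)"
      unfolding scale_sum_left by (rule sum.swap)
    finally have "(\<Sum>y\<in>T. (\<Sum>z\<in>S. a z * ?c z y) *s b y) = 0"
      using S(3) by simp
    from independent_family_scale_sum[OF assms T(1,2) this xT]
    have "(\<Sum>z\<in>S. a z * ?c z x) = 0" .
    moreover have "(\<Sum>z\<in>S. a z * ?c z x) = (\<Sum>z\<in>{x}. a z * ?c z x)"
    proof (rule sum.mono_neutral_right[OF S(1)])
      show "\<forall>z\<in>S - {x}. a z * ?c z x = 0"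
      proof
        fix z assume z: "z \<in> S - {x}"
        show "a z * ?c z x = 0"
        proof (rule ccontr)
          assume "a z * ?c z x \<noteq> 0"
          \<comment> \<open>Since \<open>z \<noteq> x\<close>, the membership
            \<open>x \<in> D z\<close> would give \<open>z\<close> a larger rank than
            \<open>x\<close>.\<close>
          then have "z \<in> S'" "x \<in> D z" using z by (auto simp: S'_def split: if_splits)
          with x(2)[of z] \<mu>[of z x] z S(2) show False by auto
        qed
      qed
    qed (use xS in auto)
    ultimately show False using x(1) D(3)[OF xS(2)] c_self[OF xS(2)] by (simp add: S'_def)
  qed
  from independent_family[OF this] show "inj_on f I" "independent (f ` I)" by blast+
qed

end

end

section \<open>The basis of fundamental functions\<close>

lemma lwc_M_Nil: "lwc_M [] = series_one"
proof
  fix m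
  have "{ns::nat list. ns = [] \<and> 0 = m} = (if m = 0 then {[]} else {})" for m :: "nat \<Rightarrow>\<^sub>0 nat"
    by auto
  then show "lwc_M [] m = series_one m"
    by (simp add: lwc_M_lookup series_one_def lookup_one when_def)
qed

lemma lwc_F_Nil: "lwc_F [] = series_one"
  using lwc_F_eq_chain_series[of "[]"] lwc_M_eq_chain_series[of "[]"] lwc_M_Nil
  by (simp add: word_def)

text \<open>Take a shortest \<open>\<delta>\<close> with nonzero coefficient. The other terms that
  occur are at least as long, so their coefficient at the test monomial of \<open>\<delta>\<close>
  vanishes.\<close>

lemma lwc_M_independent: "inj_on lwc_M indices" "series.independent (lwc_M ` indices)"
proof -
  have "\<forall>\<gamma>\<in>S. a \<gamma> = 0"
    if S: "finite S" "S \<subseteq> indices" "(\<Sum>\<gamma>\<in>S. series_scale (a \<gamma>) (lwc_M \<gamma>)) = 0" for S a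
  proof (rule ccontr)
    assume "\<not> (\<forall>\<gamma>\<in>S. a \<gamma> = 0)"
    then obtain \<delta> where \<delta>: "\<delta> \<in> S" "a \<delta> \<noteq> 0"
      and min: "\<And>\<gamma>. \<gamma> \<in> S \<Longrightarrow> a \<gamma> \<noteq> 0 \<Longrightarrow> length \<delta> \<le> length \<gamma>"
      using ex_has_least_nat[of "\<lambda>\<gamma>. \<gamma> \<in> S \<and> a \<gamma> \<noteq> 0" _ length] by blast
    let ?m = "packed_monom \<delta>"
    have "(\<Sum>\<gamma>\<in>S. series_scale (a \<gamma>) (lwc_M \<gamma>)) ?m = (\<Sum>\<gamma>\<in>S. a \<gamma> * lwc_M \<gamma> ?m)"
      by (simp add: sum_fun_apply series_scale_def)
    with S(3) have "0 = (\<Sum>\<gamma>\<in>S. a \<gamma> * lwc_M \<gamma> ?m)" by (simp add: zero_fun_def)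
    also have "\<dots> = (\<Sum>\<gamma>\<in>{\<delta>}. a \<gamma> * lwc_M \<gamma> ?m)"
    proof (rule sum.mono_neutral_right[OF S(1)])
      show "\<forall>\<gamma>\<in>S - {\<delta>}. a \<gamma> * lwc_M \<gamma> ?m = 0"
      proof
        fix \<gamma> assume \<gamma>: "\<gamma> \<in> S - {\<delta>}"
        then have "\<gamma> = [] \<or> lwc \<gamma>" "\<delta> = [] \<or> lwc \<delta>"
          using S(2) \<delta>(1) by (auto simp: indices_def)
        with lwc_M_packed_monom[of \<gamma> \<delta>] min[of \<gamma>] \<gamma> show "a \<gamma> * lwc_M \<gamma> ?m = 0"
          by fastforce
      qed
    qed (use \<delta> in auto)
    finally show False
      using lwc_M_packed_monom_self[of \<delta>] \<delta> S(2) by (auto simp: indices_def)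
  qed
  from series.independent_family[of indices lwc_M, OF this]
  show "inj_on lwc_M indices" "series.independent (lwc_M ` indices)" by blast+
qed

lemma lwc_coeff_Nil: "lwc_coeff [] [] = 1"
  using lwc_coeff_flatten[of "[]" "[]"] by simp

lemma lwc_leD: "\<beta> \<preceq> \<alpha> \<Longrightarrow> lwc \<beta>"
  by (simp add: lwc_le_def)

lemma lwc_F_basis:
  "inj_on lwc_F indices" "series.independent (lwc_F ` indices)"
  "series.span (lwc_F ` indices) = LWCQSym"
proof -
  \<comment> \<open>\<open>\<preceq>\<close> relates nonempty lists only, so the index
    \<open>[]\<close> gets the lower set \<open>{[]}\<close>.\<close>
  let ?D = "\<lambda>\<alpha>. if \<alpha> = [] then {[]} else {\<beta>. \<beta> \<preceq> \<alpha>}"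
  let ?c = "\<lambda>\<alpha> \<beta>. of_nat (lwc_coeff \<alpha> \<beta>) :: rat"
  have *: "\<And>\<alpha>. \<alpha> \<in> indices \<Longrightarrow> finite (?D \<alpha>)" "\<And>\<alpha>. \<alpha> \<in> indices \<Longrightarrow> ?D \<alpha> \<subseteq> indices"
    "\<And>\<alpha>. \<alpha> \<in> indices \<Longrightarrow> \<alpha> \<in> ?D \<alpha>"
    "\<And>\<alpha>. \<alpha> \<in> indices \<Longrightarrow> lwc_F \<alpha> = (\<Sum>\<beta>\<in>?D \<alpha>. series_scale (?c \<alpha> \<beta>) (lwc_M \<beta>))"
    "\<And>\<alpha>. \<alpha> \<in> indices \<Longrightarrow> ?c \<alpha> \<alpha> = 1"
    "\<And>\<alpha> \<beta>. \<alpha> \<in> indices \<Longrightarrow> \<beta> \<in> ?D \<alpha> \<Longrightarrow> \<beta> \<noteq> \<alpha> \<Longrightarrow> coarseness \<beta> < coarseness \<alpha>"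
    by (auto simp: indices_def finite_lwc_le lwc_le_refl lwc_F_expansion lwc_F_Nil
        lwc_M_Nil lwc_coeff_Nil lwc_coeff_self coarseness_lwc_le dest: lwc_leD split: if_splits)
  note tri = series.unitriangular_independent[of indices ?D lwc_F ?c lwc_M coarseness, OF * lwc_M_independent]
    series.unitriangular_span[of indices ?D lwc_F ?c lwc_M coarseness, OF *]
  show "inj_on lwc_F indices" by (rule tri(1))
  show "series.independent (lwc_F ` indices)" by (rule tri(2))
  have "series.span (lwc_F ` indices) = series.span (lwc_M ` indices)" by (rule tri(3))
  then show "series.span (lwc_F ` indices) = LWCQSym"
    by (simp add: LWCQSym_def indices_def lwc_M_Nil)
qed

theorem theorem4p3:
  shows "(\<forall>\<alpha>. lwc \<alpha> \<longrightarrow>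
            lwc_F \<alpha> = (\<Sum>\<beta> | \<beta> \<preceq> \<alpha>. series_scale (of_nat (lwc_coeff \<alpha> \<beta>)) (lwc_M \<beta>)) \<and>
            (\<forall>\<beta> js bs. block_refinement \<alpha> js bs \<beta> \<longrightarrow>
               lwc_coeff \<alpha> \<beta> = (\<Prod>p<num_blocks \<alpha>. zeros_at \<alpha> p choose (js ! p))) \<and>
            lwc_coeff \<alpha> \<alpha> = 1) \<and>
         lwc_F [] = series_one \<and>
         inj_on lwc_F (insert [] {\<alpha>. lwc \<alpha>}) \<and>
         series.independent (lwc_F ` insert [] {\<alpha>. lwc \<alpha>}) \<and>
         series.span (lwc_F ` insert [] {\<alpha>. lwc \<alpha>}) = LWCQSym"
  using lwc_F_expansion lwc_coeff_block_refinement lwc_coeff_self lwc_F_Nil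
    lwc_F_basis[unfolded indices_def] by blast

end
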